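(* Let $(u,v)$ be the current approximation to $(u^*,v^* )$, let $\varepsilon$ be the relative error of the approximate solution $(\widetilde s,\widetilde t)$ of the correction equation, let $\widetilde\varepsilon$ be the accuracy of the expansion vectors, and let $\alpha=\theta-\tau+u^TAt$, $\beta=\theta-\tau+v^TA^Ts$, where $(s,t)$ is the exact solution of the correction equation. Then $$\varepsilon\le\frac{2\sqrt{\alpha^2+\beta^2}\,\sin_{\max}}{|\sigma-\tau|\left\|B\begin{bmatrix} \alpha u \\ \beta v \end{bmatrix}-\begin{bmatrix} u \\ v \end{bmatrix}\right\|\sqrt{\|g_\perp\|^2+\|h_\perp\|^2}}\;\widetilde\varepsilon ,$$ where $\sin_{\max}=\max\{\sin\varphi,\sin\psi\}$ with the acute angles $\varphi=\angle(u,u^* )$, $\psi=\angle(v,v^* )$.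
   Context: $\|\cdot\|$ is the 2-norm. $A\in\mathbb{R}^{M\times N}$, $M\ge N$, has singular values $\sigma_1,\dots,\sigma_N$ labeled so that $|\sigma_1-\tau|<|\sigma_2-\tau|\le\dots\le|\sigma_N-\tau|$, where the target $\tau>0$ is not a singular value of $A$. $(\sigma,u^*,v^* )=(\sigma_1,u_1,v_1)$ is the corresponding singular triplet: $Av^*=\sigma u^*$, $A^Tu^*=\sigma v^*$, $\|u^*\|=\|v^*\|=1$. Put $$B=\begin{bmatrix} -\tau I_M & A \\ A^T & -\tau I_N \end{bmatrix}^{-1}.$$ $\mathcal U\subset\mathbb{R}^M$, $\mathcal V\subset\mathbb{R}^N$ are $m$-dimensional searching subspaces with orthogonal projectors $P_U$, $P_V$ onto them; $u\in\mathcal U$, $v\in\mathcal V$ are unit vectors; $\theta=u^TAv\ge0$; $(\theta,u,v)$ is a reasonably good but not yet converged approximation to $(\sigma,u^*,v^* )$; $r=\begin{bmatrix} Av-\theta u \\ A^Tu-\theta v \end{bmatrix}$. The correction equation is $$\begin{bmatrix} I_M-uu^T & \\ & I_N-vv^T \end{bmatrix}\begin{bmatrix} -\tau I_M & A \\ A^T & -\tau I_N \end{bmatrix}\begin{bmatrix} I_M-uu^T & \\ & I_N-vv^T \end{bmatrix}\begin{bmatrix} s \\ t \end{bmatrix}=-r,\qquad s\perp u,\ t\perp v.$$ For an approximate solution $(\widetilde s,\widetilde t)$ define $\varepsilon=\left\|\begin{bmatrix} \widetilde s \\ \widetilde t \end{bmatrix}-\begin{bmatrix} s \\ t \end{bmatrix}\right\|\Big/\left\|\begin{bmatrix}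 s \\ t \end{bmatrix}\right\|$, and let $[g^T,h^T]^T$ be the normalized error direction: $\begin{bmatrix} \widetilde s \\ \widetilde t \end{bmatrix}=\begin{bmatrix} s \\ t \end{bmatrix}+\varepsilon\left\|\begin{bmatrix} s \\ t \end{bmatrix}\right\|\begin{bmatrix} g \\ h \end{bmatrix}$ with $\|g\|^2+\|h\|^2=1$. Put $g_\perp=(I_M-P_U)g$, $h_\perp=(I_N-P_V)h$. The accuracy of the expansion vectors is $\widetilde\varepsilon=\max\{\widetilde\varepsilon_s,\widetilde\varepsilon_t\}$ with $$\widetilde\varepsilon_s=\frac{\|(I_M-P_U)(\widetilde s-s)\|}{\|(I_M-P_U)s\|},\qquad\widetilde\varepsilon_t=\frac{\|(I_N-P_V)(\widetilde t-t)\|}{\|(I_N-P_V)t\|}.$$ All denominators occurring are understood to be nonzero.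
   Formalization: When M > N it is additionally assumed that |σ − τ| ≤ τ, so that 0, then also an eigenvalue of the augmented matrix, is no closer to τ than σ; without this the stated bound can fail. Nothing is added for M = N. *)

theory Defs
  imports "HOL-Analysis.Analysis"
begin

text \<open>
  The block vector with upper part x and lower part y, and the 2 by 2 block matrix
  with first block row P, Q and second block row R, S.
\<close>

definition blockvec :: "real^'a \<Rightarrow> real^'b \<Rightarrow> real^('a + 'b)" where
  "blockvec x y = (\<chi> i. case i of Inl a \<Rightarrow> x $ a | Inr b \<Rightarrow> y $ b)"

definition blockmat ::
  "real^'a^'c \<Rightarrow> real^'b^'c \<Rightarrow> real^'a^'d \<Rightarrow> real^'b^'d \<Rightarrow> real^('a + 'b)^('c + 'd)" where
  "blockmat P Q R S = (\<chi> i j.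
     case i of
       Inl c \<Rightarrow> (case j of Inl a \<Rightarrow> P $ c $ a | Inr b \<Rightarrow> Q $ c $ b)
     | Inr d \<Rightarrow> (case j of Inl a \<Rightarrow> R $ d $ a | Inr b \<Rightarrow> S $ d $ b))"

definition outer :: "real^'a \<Rightarrow> real^'b \<Rightarrow> real^'b^'a" where
  "outer x y = (\<chi> i j. x $ i * y $ j)"

text \<open>
  The shifted augmented matrix, whose inverse is B. Before the shift its eigenvalues are plus and
  minus the singular values of A and, if A has more rows than columns, also 0. So the singular
  value of A nearest to \<tau> > 0 is its eigenvalue nearest to \<tau>, except that for M > N this
  requires that singular value to be within distance \<tau> of \<tau>. The theorem assumes the latter for
  M > N; without that assumption its bound can fail.
\<close>

definition shifted_augmented :: "real^'n^'m \<Rightarrow> real \<Rightarrow> real^('m + 'n)^('m + 'n)" where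
  "shifted_augmented A \<tau> = blockmat (mat (- \<tau>)) A (transpose A) (mat (- \<tau>))"

definition deflation :: "real^'m \<Rightarrow> real^'n \<Rightarrow> real^('m + 'n)^('m + 'n)" where
  "deflation u v = blockmat (mat 1 - outer u u) 0 0 (mat 1 - outer v v)"

definition orthonormal_family :: "nat set \<Rightarrow> (nat \<Rightarrow> real^'a) \<Rightarrow> bool" where
  "orthonormal_family I x \<longleftrightarrow> (\<forall>i\<in>I. \<forall>j\<in>I. x i \<bullet> x j = (if i = j then 1 else 0))"

text \<open>
  For an M by N matrix A with M at least N, the numbers \<sigma> 1, ..., \<sigma> N are its singular values,
  listed with multiplicity and in no particular order, if they are the coefficients of a
  thin singular value decomposition of A. Values of \<sigma> outside 1..N are irrelevant.
\<close>

definition are_singular_values :: "real^'n^'m \<Rightarrow> (nat \<Rightarrow> real) \<Rightarrow> bool" where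
  "are_singular_values A \<sigma> \<longleftrightarrow>
     (\<forall>i\<in>{1..CARD('n)}. 0 \<le> \<sigma> i) \<and>
     (\<exists>x y. orthonormal_family {1..CARD('n)} x \<and> orthonormal_family {1..CARD('n)} y \<and>
            A = (\<Sum>i = 1..CARD('n). \<sigma> i *\<^sub>R outer (x i) (y i)))"

definition is_singular_triplet :: "real^'n^'m \<Rightarrow> real \<Rightarrow> real^'m \<Rightarrow> real^'n \<Rightarrow> bool" where
  "is_singular_triplet A s x y \<longleftrightarrow>
     A *v y = s *\<^sub>R x \<and> transpose A *v x = s *\<^sub>R y \<and> norm x = 1 \<and> norm y = 1"

definition is_orthogonal_projector :: "real^'a^'a \<Rightarrow> (real^'a) set \<Rightarrow> bool" where
  "is_orthogonal_projector P W \<longleftrightarrow>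
     P ** P = P \<and> transpose P = P \<and> range ((*v) P) = W"

text \<open>The angle between the lines spanned by x and y, hence in the interval from 0 to \<pi>/2.\<close>

definition acute_angle :: "real^'a \<Rightarrow> real^'a \<Rightarrow> real" where
  "acute_angle x y = arccos (\<bar>x \<bullet> y\<bar> / (norm x * norm y))"

end

theory Submission
  imports Defs
begin

text \<open>
  Write K for the shifted augmented matrix. Projecting out u and v only subtracts multiples of u and
  v, so the correction equation says that K maps the block vector with parts s + u and t + v to the
  one with parts \<alpha> u and \<beta> v. This gives the norm of the exact solution. As the projections onto
  the complements of the searching spaces annihilate u and v, it remains to bound the projected
  preimage under K of the block vector with parts \<alpha> u and \<beta> v. Split u and v along ustar and vstar.
  The preimage of the parallel part is again parallel to ustar and vstar, so that the projections
  shrink it by the sines of the angles; the orthogonal part is itself small by these sines. In both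
  cases K expands norms by at least the distance of \<tau> to the nearest singular value.
\<close>

section \<open>Block vectors, their norms and products with block matrices\<close>

lemma sum_UNIV_Plus:
  fixes f :: "('a::finite + 'b::finite) \<Rightarrow> real"
  shows "sum f UNIV = (\<Sum>a\<in>UNIV. f (Inl a)) + (\<Sum>b\<in>UNIV. f (Inr b))"
  by (simp flip: UNIV_Plus_UNIV add: sum.Plus)

lemma norm_blockvec_power2: "(norm (blockvec x y))\<^sup>2 = (norm x)\<^sup>2 + (norm y)\<^sup>2"
  by (simp add: power2_norm_eq_inner inner_vec_def sum_UNIV_Plus blockvec_def)

lemma norm_blockvec: "norm (blockvec x y) = sqrt ((norm x)\<^sup>2 + (norm y)\<^sup>2)"
  by (metis norm_blockvec_power2 norm_ge_zero real_sqrt_unique)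

lemma blockvec_add: "blockvec a b + blockvec c d = blockvec (a + c) (b + d)"
  by (auto simp: blockvec_def vec_eq_iff split: sum.split)

lemma blockvec_diff: "blockvec a b - blockvec c d = blockvec (a - c) (b - d)"
  by (auto simp: blockvec_def vec_eq_iff split: sum.split)

lemma blockvec_minus: "- blockvec a b = blockvec (- a) (- b)"
  by (auto simp: blockvec_def vec_eq_iff split: sum.split)

lemma blockvec_scaleR: "c *\<^sub>R blockvec a b = blockvec (c *\<^sub>R a) (c *\<^sub>R b)"
  by (auto simp: blockvec_def vec_eq_iff split: sum.split)

lemma blockvec_eq_iff: "blockvec a b = blockvec c d \<longleftrightarrow> a = c \<and> b = d"
proof
  assume eq: "blockvec a b = blockvec c d"
  have "a $ i = c $ i" for i
    using arg_cong[OF eq, of "\<lambda>z. z $ Inl i"] by (simp add: blockvec_def)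
  moreover have "b $ j = d $ j" for j
    using arg_cong[OF eq, of "\<lambda>z. z $ Inr j"] by (simp add: blockvec_def)
  ultimately show "a = c \<and> b = d"
    by (simp add: vec_eq_iff)
qed simp

lemma blockvec_surj: "\<exists>a b. z = blockvec a b"
proof (intro exI)
  show "z = blockvec (\<chi> i. z $ Inl i) (\<chi> i. z $ Inr i)"
    by (auto simp: blockvec_def vec_eq_iff split: sum.split)
qed

lemma blockmat_mult_blockvec:
  "blockmat P Q R S *v blockvec a b = blockvec (P *v a + Q *v b) (R *v a + S *v b)"
  by (auto simp: blockvec_def blockmat_def vec_eq_iff matrix_vector_mult_def sum_UNIV_Plus
      split: sum.split)

lemma outer_mult_vector: "outer x y *v z = (y \<bullet> z) *\<^sub>R x"
  by (simp add: outer_def vec_eq_iff matrix_vector_mult_def inner_vec_def sum_distrib_left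
      sum_distrib_right mult_ac)

lemma mat_mult_vector: "mat c *v (x :: real^'a) = c *\<^sub>R x"
  by (simp add: vec_eq_iff matrix_vector_mult_def mat_def if_distrib[of "\<lambda>z. z * _"] cong: if_cong)

lemma shifted_augmented_mult_blockvec:
  "shifted_augmented A \<tau> *v blockvec a b = blockvec (A *v b - \<tau> *\<^sub>R a) (transpose A *v a - \<tau> *\<^sub>R b)"
  by (simp add: shifted_augmented_def blockmat_mult_blockvec mat_mult_vector)

lemma deflation_mult_blockvec:
  "deflation u v *v blockvec a b = blockvec (a - (u \<bullet> a) *\<^sub>R u) (b - (v \<bullet> b) *\<^sub>R v)"
  by (simp add: deflation_def blockmat_mult_blockvec matrix_vector_mult_diff_rdistrib
      outer_mult_vector)

section \<open>Orthonormal expansions and the lower bound for the shifted augmented matrix\<close>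

lemma inner_orthonormal_sum:
  assumes "orthonormal_family I x" "finite I" "i \<in> I"
  shows "(\<Sum>j\<in>I. c j *\<^sub>R x j) \<bullet> x i = c i"
proof -
  have "(\<Sum>j\<in>I. c j *\<^sub>R x j) \<bullet> x i = (\<Sum>j\<in>I. if j = i then c j else 0)"
    unfolding inner_sum_left
    by (intro sum.cong refl) (use assms in \<open>auto simp: orthonormal_family_def\<close>)
  then show ?thesis
    using assms by simp
qed

text \<open>Pythagoras: for the projection \<open>p\<close> of \<open>a\<close> onto the span of the
  family, \<open>a \<bullet> p\<close> and \<open>p \<bullet> p\<close> are both the sum of squared
  coefficients, so the remainder is orthogonal to \<open>p\<close>.\<close>

lemma norm_orthonormal_decomp:
  assumes "orthonormal_family I x" "finite I"
  shows "(norm a)\<^sup>2 = (\<Sum>i\<in>I. (a \<bullet> x i)\<^sup>2) + (norm (a - (\<Sum>i\<in>I. (a \<bullet> x i) *\<^sub>R x i)))\<^sup>2"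
proof -
  define p where "p = (\<Sum>i\<in>I. (a \<bullet> x i) *\<^sub>R x i)"
  have ap: "a \<bullet> p = (\<Sum>i\<in>I. (a \<bullet> x i)\<^sup>2)"
    by (simp add: p_def inner_sum_right power2_eq_square)
  have "p \<bullet> p = (\<Sum>i\<in>I. (a \<bullet> x i) * (p \<bullet> x i))"
    by (subst (2) p_def) (simp add: inner_sum_right)
  also have "\<dots> = (\<Sum>i\<in>I. (a \<bullet> x i)\<^sup>2)"
    using inner_orthonormal_sum[OF assms, of _ "\<lambda>i. a \<bullet> x i"]
    by (intro sum.cong refl) (simp add: p_def power2_eq_square)
  finally have "p \<bullet> p = (\<Sum>i\<in>I. (a \<bullet> x i)\<^sup>2)" .
  with ap show ?thesis
    unfolding p_def[symmetric]
    by (simp add: power2_norm_eq_inner inner_diff_left inner_diff_right inner_commute)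
qed

text \<open>A nonzero remainder would be orthogonal to every \<open>y i\<close>; together with them
  it would form \<open>CARD('a) + 1\<close> independent vectors.\<close>

lemma orthonormal_family_complete:
  fixes y :: "nat \<Rightarrow> real^'a"
  assumes "orthonormal_family I y" "finite I" "card I = CARD('a)"
  shows "(\<Sum>i\<in>I. (b \<bullet> y i) *\<^sub>R y i) = b"
proof (rule ccontr)
  assume neq: "(\<Sum>i\<in>I. (b \<bullet> y i) *\<^sub>R y i) \<noteq> b"
  define r where "r = b - (\<Sum>i\<in>I. (b \<bullet> y i) *\<^sub>R y i)"
  have r0: "r \<noteq> 0"
    using neq by (simp add: r_def)
  have r: "r \<bullet> y i = 0" if "i \<in> I" for i
    using inner_orthonormal_sum[OF assms(1,2) that, of "\<lambda>i. b \<bullet> y i"]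
    by (simp add: r_def inner_diff_left)
  have yy: "y i \<bullet> y j = (if i = j then 1 else 0)" if "i \<in> I" "j \<in> I" for i j
    using assms(1) that by (simp add: orthonormal_family_def)
  have "inj_on y I"
    by (rule inj_onI) (metis yy zero_neq_one)
  then have card: "card (y ` I) = CARD('a)"
    using assms(3) by (simp add: card_image)
  have "r \<notin> y ` I"
    using r r0 by (metis imageE inner_eq_zero_iff)
  then have "card (insert r (y ` I)) = Suc CARD('a)"
    using card assms(2) by simp
  moreover have "pairwise orthogonal (insert r (y ` I))"
    unfolding pairwise_def orthogonal_def using r yy by (auto simp: inner_commute)
  moreover have "0 \<notin> insert r (y ` I)"
    using r0 yy by (metis imageE inner_zero_left insertE zero_neq_one)
  ultimately show False
    using pairwise_orthogonal_independent independent_bound[of "insert r (y ` I)"] by fastforce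
qed

text \<open>A pair of singular vectors reduces the matrix to the symmetric 2 by 2 block with
  diagonal -\<tau> and off-diagonal \<open>\<sigma> i\<close>. Its eigenvalues
  \<open>\<sigma> i - \<tau>\<close> and \<open>- \<sigma> i - \<tau>\<close> both have modulus at
  least \<open>\<bar>\<sigma> i - \<tau>\<bar>\<close>, since \<open>\<sigma> i\<close> and \<tau>
  are nonnegative. Left directions outside the span of the \<open>x i\<close> are multiplied by
  -\<tau>; they exist only for more rows than columns, where \<open>kernel\<close> covers
  them.\<close>

lemma shifted_augmented_expands:
  fixes A :: "real^'n^'m"
  assumes "are_singular_values A \<sigma>" "0 \<le> d" "0 \<le> \<tau>"
    and dist: "\<And>i. i \<in> {1..CARD('n)} \<Longrightarrow> d \<le> \<bar>\<sigma> i - \<tau>\<bar>"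
    and "CARD('n) \<le> CARD('m)" and kernel: "CARD('n) < CARD('m) \<Longrightarrow> d \<le> \<tau>"
  shows "d * norm z \<le> norm (shifted_augmented A \<tau> *v z)"
proof -
  let ?I = "{1..CARD('n)}"
  obtain x y where x: "orthonormal_family ?I x" and y: "orthonormal_family ?I y"
    and A: "A = (\<Sum>i\<in>?I. \<sigma> i *\<^sub>R outer (x i) (y i))" and \<sigma>: "\<And>i. i \<in> ?I \<Longrightarrow> 0 \<le> \<sigma> i"
    using assms(1) unfolding are_singular_values_def by blast
  obtain a b where z: "z = blockvec a b"
    using blockvec_surj by blast
  have Ab: "A *v w = (\<Sum>i\<in>?I. (\<sigma> i * (y i \<bullet> w)) *\<^sub>R x i)" for w
  proof -
    have "(\<Sum>i\<in>J. \<sigma> i *\<^sub>R outer (x i) (y i)) *v w = (\<Sum>i\<in>J. (\<sigma> i * (y i \<bullet> w)) *\<^sub>R x i)"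
      if "finite J" for J
      using that
      by induction (auto simp: matrix_vector_mult_add_rdistrib outer_mult_vector
          scaleR_matrix_vector_assoc[symmetric])
    then show ?thesis
      by (simp add: A)
  qed
  have Abx: "(A *v w) \<bullet> x i = \<sigma> i * (w \<bullet> y i)" if "i \<in> ?I" for i w
    using inner_orthonormal_sum[OF x _ that, of "\<lambda>i. \<sigma> i * (y i \<bullet> w)"]
    by (simp add: Ab inner_commute)
  have Ay: "A *v y i = \<sigma> i *\<^sub>R x i" if "i \<in> ?I" for i
  proof -
    have "A *v y i = (\<Sum>j\<in>?I. if j = i then \<sigma> i *\<^sub>R x i else 0)"
      unfolding Ab by (intro sum.cong refl) (use y that in \<open>auto simp: orthonormal_family_def\<close>)
    then show ?thesis
      using that by simp
  qed
  have Aty: "(transpose A *v a) \<bullet> y i = \<sigma> i * (a \<bullet> x i)" if "i \<in> ?I" for i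
    by (metis Ay[OF that] dot_lmul_matrix inner_scaleR_right transpose_matrix_vector)
  \<comment> \<open>This is the part of \<open>a\<close> orthogonal to all left singular vectors
    \<open>x i\<close>.\<close>
  define ra where "ra = a - (\<Sum>i\<in>?I. (a \<bullet> x i) *\<^sub>R x i)"
  \<comment> \<open>\<open>A *v b\<close> lies in the span of the \<open>x i\<close>, so only the
    shift contributes to the remainder.\<close>
  have rem: "(A *v b - \<tau> *\<^sub>R a) - (\<Sum>i\<in>?I. ((A *v b - \<tau> *\<^sub>R a) \<bullet> x i) *\<^sub>R x i) = - \<tau> *\<^sub>R ra"
  proof -
    have "(\<Sum>i\<in>?I. ((A *v b - \<tau> *\<^sub>R a) \<bullet> x i) *\<^sub>R x i)
        = (\<Sum>i\<in>?I. (\<sigma> i * (y i \<bullet> b)) *\<^sub>R x i - \<tau> *\<^sub>R ((a \<bullet> x i) *\<^sub>R x i))"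
      by (intro sum.cong refl)
        (simp only: inner_diff_left Abx scaleR_diff_left inner_scaleR_left scaleR_scaleR
          inner_commute[of b])
    also have "\<dots> = A *v b - \<tau> *\<^sub>R (\<Sum>i\<in>?I. (a \<bullet> x i) *\<^sub>R x i)"
      by (simp add: sum_subtractf Ab scaleR_sum_right)
    finally show ?thesis
      by (simp add: ra_def algebra_simps)
  qed
  have na: "(norm a)\<^sup>2 = (\<Sum>i\<in>?I. (a \<bullet> x i)\<^sup>2) + (norm ra)\<^sup>2"
    unfolding ra_def by (rule norm_orthonormal_decomp[OF x]) simp
  \<comment> \<open>There are as many \<open>y i\<close> as dimensions, so \<open>b\<close> has no
    remainder.\<close>
  have nb: "(norm b)\<^sup>2 = (\<Sum>i\<in>?I. (b \<bullet> y i)\<^sup>2)"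
    using norm_orthonormal_decomp[OF y, of b] orthonormal_family_complete[OF y, of b] by simp
  have nK1: "(norm (A *v b - \<tau> *\<^sub>R a))\<^sup>2
      = (\<Sum>i\<in>?I. (\<sigma> i * (b \<bullet> y i) - \<tau> * (a \<bullet> x i))\<^sup>2) + \<tau>\<^sup>2 * (norm ra)\<^sup>2"
    using norm_orthonormal_decomp[OF x, of "A *v b - \<tau> *\<^sub>R a"] unfolding rem
    by (simp add: inner_diff_left Abx power_mult_distrib)
  \<comment> \<open>Bessel's inequality is enough here, as only a lower bound on the norm of the
    image is sought.\<close>
  have nK2: "(\<Sum>i\<in>?I. (\<sigma> i * (a \<bullet> x i) - \<tau> * (b \<bullet> y i))\<^sup>2) \<le> (norm (transpose A *v a - \<tau> *\<^sub>R b))\<^sup>2"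
    using norm_orthonormal_decomp[OF y, of "transpose A *v a - \<tau> *\<^sub>R b"]
    by (simp add: inner_diff_left Aty[unfolded transpose_matrix_vector])
  \<comment> \<open>The estimate for one 2 by 2 block. The right side exceeds
    \<open>(\<sigma> i - \<tau>)\<^sup>2 * (p\<^sup>2 + q\<^sup>2)\<close> by exactly
    \<open>2 * (\<sigma> i * \<tau>) * (p - q)\<^sup>2\<close>, which is nonnegative.\<close>
  have pair: "d\<^sup>2 * (p\<^sup>2 + q\<^sup>2) \<le> (\<sigma> i * q - \<tau> * p)\<^sup>2 + (\<sigma> i * p - \<tau> * q)\<^sup>2" if "i \<in> ?I" for i p q
  proof -
    have "d\<^sup>2 \<le> (\<sigma> i - \<tau>)\<^sup>2"
      using dist[OF that] assms(2) by (metis abs_le_square_iff abs_of_nonneg)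
    then have "d\<^sup>2 * (p\<^sup>2 + q\<^sup>2) \<le> (\<sigma> i - \<tau>)\<^sup>2 * (p\<^sup>2 + q\<^sup>2)"
      by (simp add: mult_right_mono)
    also have "\<dots> \<le> (\<sigma> i - \<tau>)\<^sup>2 * (p\<^sup>2 + q\<^sup>2) + 2 * (\<sigma> i * \<tau>) * (p - q)\<^sup>2"
      using \<sigma>[OF that] assms(3) by simp
    also have "\<dots> = (\<sigma> i * q - \<tau> * p)\<^sup>2 + (\<sigma> i * p - \<tau> * q)\<^sup>2"
      by (simp add: power2_eq_square algebra_simps)
    finally show ?thesis .
  qed
  \<comment> \<open>With more rows than columns this is \<open>d \<le> \<tau>\<close>; for a square
    matrix the \<open>x i\<close> are complete and \<open>ra\<close> vanishes.\<close>
  have rest: "d\<^sup>2 * (norm ra)\<^sup>2 \<le> \<tau>\<^sup>2 * (norm ra)\<^sup>2"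
  proof (cases "CARD('n) < CARD('m)")
    case True
    then show ?thesis
      using kernel assms(2) by (intro mult_right_mono power_mono) auto
  next
    case False
    then have "ra = 0"
      using orthonormal_family_complete[OF x, of a] assms(5) by (simp add: ra_def)
    then show ?thesis
      by simp
  qed
  have "(d * norm z)\<^sup>2 = (\<Sum>i\<in>?I. d\<^sup>2 * ((a \<bullet> x i)\<^sup>2 + (b \<bullet> y i)\<^sup>2)) + d\<^sup>2 * (norm ra)\<^sup>2"
    by (simp add: z power_mult_distrib norm_blockvec_power2 na nb sum.distrib algebra_simps
        sum_distrib_left)
  also have "\<dots> \<le> (\<Sum>i\<in>?I. (\<sigma> i * (b \<bullet> y i) - \<tau> * (a \<bullet> x i))\<^sup>2 + (\<sigma> i * (a \<bullet> x i) - \<tau> * (b \<bullet> y i))\<^sup>2)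
      + \<tau>\<^sup>2 * (norm ra)\<^sup>2"
    by (intro add_mono sum_mono pair rest)
  also have "\<dots> \<le> (norm (shifted_augmented A \<tau> *v z))\<^sup>2"
    using nK1 nK2 by (simp add: z shifted_augmented_mult_blockvec norm_blockvec_power2 sum.distrib)
  finally show ?thesis
    by (rule power2_le_imp_le) simp
qed

section \<open>Matrix inverse, orthogonal projectors and angles\<close>

lemma matrix_inv_mult_vector_eq:
  fixes K :: "real^'a^'a"
  assumes "inj ((*v) K)"
  shows "matrix_inv K *v (K *v z) = z"
proof -
  have "invertible K"
    using assms by (simp add: invertible_left_inverse matrix_left_invertible_injective)
  then show ?thesis
    unfolding matrix_inv_def invertible_def
    by (metis (mono_tags, lifting) matrix_vector_mul_assoc matrix_vector_mul_lid someI_ex)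
qed

lemma orthogonal_projector_annihilates:
  assumes "is_orthogonal_projector P W" "w \<in> W"
  shows "(mat 1 - P) *v w = 0"
proof -
  obtain z where "w = P *v z" and "P ** P = P"
    using assms unfolding is_orthogonal_projector_def by blast
  then have "P *v w = w"
    by (simp add: matrix_vector_mul_assoc)
  then show ?thesis
    by (simp add: matrix_vector_mult_diff_rdistrib)
qed

text \<open>Symmetry and idempotence make \<open>P *v x\<close> orthogonal to
  \<open>x - P *v x\<close>, so Pythagoras applies.\<close>

lemma norm_orthogonal_projector_compl_le:
  assumes "is_orthogonal_projector P W"
  shows "norm ((mat 1 - P) *v x) \<le> norm x"
proof -
  have "P *v (P *v x) = P *v x" and "(P *v x) \<bullet> x = (P *v x) \<bullet> (P *v x)"
    using assms unfolding is_orthogonal_projector_def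
    by (simp add: matrix_vector_mul_assoc,
        metis dot_lmul_matrix inner_commute matrix_vector_mul_assoc transpose_matrix_vector)
  then have "(norm (x - P *v x))\<^sup>2 = (norm x)\<^sup>2 - (norm (P *v x))\<^sup>2"
    by (simp add: power2_norm_eq_inner inner_diff_left inner_diff_right inner_commute)
  then have "(norm (x - P *v x))\<^sup>2 \<le> (norm x)\<^sup>2"
    by simp
  then show ?thesis
    by (simp add: matrix_vector_mult_diff_rdistrib)
qed

text \<open>Removing the component of \<open>w\<close> along \<open>u\<close> leaves squared length
  \<open>1 - (u \<bullet> w)\<^sup>2\<close>. The absolute value in \<open>acute_angle\<close>
  disappears in the square, so this is the squared sine.\<close>

lemma norm_residual_unit:
  assumes "norm u = 1" "norm w = 1"
  shows "norm (w - (u \<bullet> w) *\<^sub>R u) = sin (acute_angle u w)"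
proof -
  have "\<bar>u \<bullet> w\<bar> \<le> 1"
    using Cauchy_Schwarz_ineq2[of u w] assms by simp
  then have "sin (acute_angle u w) = sqrt (1 - (u \<bullet> w)\<^sup>2)"
    using assms by (simp add: acute_angle_def sin_arccos_abs)
  moreover have "(norm (w - (u \<bullet> w) *\<^sub>R u))\<^sup>2 = 1 - (u \<bullet> w)\<^sup>2"
    using assms unfolding power2_norm_eq_inner norm_eq_1
    by (simp add: inner_diff_left inner_diff_right inner_commute power2_eq_square)
  ultimately show ?thesis
    by (metis norm_ge_zero real_sqrt_unique)
qed

text \<open>The complementary projection kills \<open>u\<close>, so the component of
  \<open>w\<close> along \<open>u\<close> can be removed first; projecting the residual does not
  lengthen it.\<close>

lemma norm_orthogonal_projector_compl_le_sin:
  assumes "is_orthogonal_projector P W" "u \<in> W" "norm u = 1" "norm w = 1"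
  shows "norm ((mat 1 - P) *v w) \<le> sin (acute_angle u w)"
proof -
  have "(mat 1 - P) *v w = (mat 1 - P) *v (w - (u \<bullet> w) *\<^sub>R u)"
    by (simp add: matrix_vector_mult_diff_distrib matrix_vector_mult_scaleR
        orthogonal_projector_annihilates[OF assms(1,2)])
  then show ?thesis
    using norm_orthogonal_projector_compl_le[OF assms(1), of "w - (u \<bullet> w) *\<^sub>R u"]
    by (simp add: norm_residual_unit[OF assms(3,4)])
qed

lemma acute_angle_commute: "acute_angle x y = acute_angle y x"
  by (simp add: acute_angle_def inner_commute mult.commute)

section \<open>Block norm estimates and preimages under the shifted augmented matrix\<close>

lemma norm_blockvec_scaled_le:
  assumes "norm x \<le> c" "norm y \<le> c"
  shows "norm (blockvec (p *\<^sub>R x) (q *\<^sub>R y)) \<le> sqrt (p\<^sup>2 + q\<^sup>2) * c"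
proof (rule power2_le_imp_le)
  have c: "0 \<le> c"
    using assms(1) norm_ge_zero order_trans by blast
  have "(norm (blockvec (p *\<^sub>R x) (q *\<^sub>R y)))\<^sup>2 = p\<^sup>2 * (norm x)\<^sup>2 + q\<^sup>2 * (norm y)\<^sup>2"
    by (simp add: norm_blockvec_power2 power_mult_distrib)
  also have "\<dots> \<le> p\<^sup>2 * c\<^sup>2 + q\<^sup>2 * c\<^sup>2"
    using assms by (intro add_mono mult_left_mono power_mono) auto
  also have "\<dots> = (sqrt (p\<^sup>2 + q\<^sup>2) * c)\<^sup>2"
    by (simp add: power_mult_distrib algebra_simps)
  finally show "(norm (blockvec (p *\<^sub>R x) (q *\<^sub>R y)))\<^sup>2 \<le> (sqrt (p\<^sup>2 + q\<^sup>2) * c)\<^sup>2" .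
  show "0 \<le> sqrt (p\<^sup>2 + q\<^sup>2) * c"
    using c by simp
qed

lemma norm_blockvec_mono:
  assumes "norm a \<le> norm c" "norm b \<le> norm d"
  shows "norm (blockvec a b) \<le> norm (blockvec c d)"
  unfolding norm_blockvec using assms by (intro real_sqrt_le_mono add_mono power_mono) auto

text \<open>The block vectors with parts along \<open>x\<close> and \<open>y\<close> form an
  invariant plane, on which the matrix acts as the 2 by 2 block with diagonal -\<tau> and
  off-diagonal \<open>s\<close>. Its determinant \<open>\<tau>\<^sup>2 - s\<^sup>2\<close> is
  nonzero.\<close>

lemma preimage_on_triplet:
  assumes "is_singular_triplet A s x y" "s\<^sup>2 \<noteq> \<tau>\<^sup>2"
  obtains p q where "shifted_augmented A \<tau> *v blockvec (p *\<^sub>R x) (q *\<^sub>R y) = blockvec (a *\<^sub>R x) (b *\<^sub>R y)"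
proof
  define e where "e = s\<^sup>2 - \<tau>\<^sup>2"
  have e: "e \<noteq> 0"
    using assms(2) by (simp add: e_def)
  \<comment> \<open>Cramer's rule for the system \<open>q * s - \<tau> * p = a\<close>,
    \<open>p * s - \<tau> * q = b\<close>.\<close>
  let ?p = "(\<tau> * a + s * b) / e" and ?q = "(s * a + \<tau> * b) / e"
  \<comment> \<open>Keeping the factor \<open>e / e\<close> reduces both claims to polynomial
    identities in the numerators; it is cancelled afterwards.\<close>
  have "?q * s - \<tau> * ?p = a * (e / e)" "?p * s - \<tau> * ?q = b * (e / e)"
    unfolding times_divide_eq_right times_divide_eq_left diff_divide_distrib[symmetric]
    by (simp_all add: e_def power2_eq_square algebra_simps)
  then have "?q * s - \<tau> * ?p = a" "?p * s - \<tau> * ?q = b"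
    using e by simp_all
  then show "shifted_augmented A \<tau> *v blockvec (?p *\<^sub>R x) (?q *\<^sub>R y) = blockvec (a *\<^sub>R x) (b *\<^sub>R y)"
    using assms(1) unfolding is_singular_triplet_def
    by (simp add: shifted_augmented_mult_blockvec matrix_vector_mult_scaleR
        flip: scaleR_diff_left)
qed

text \<open>By \<open>s \<bullet> u = 0\<close> and \<open>t \<bullet> v = 0\<close> the right
  deflation acts as the identity on the solution, and the left one subtracts
  \<open>u \<bullet> (A *v t)\<close> times \<open>u\<close> and
  \<open>v \<bullet> (transpose A *v s)\<close> times \<open>v\<close>. Adding the image of
  \<open>blockvec u v\<close> cancels the terms \<open>A *v v\<close> and
  \<open>transpose A *v u\<close> of the residual, so that only multiples of \<open>u\<close> and
  \<open>v\<close> survive.\<close>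

lemma correction_solution_eq:
  assumes "\<theta> = u \<bullet> (A *v v)" "norm u = 1" "norm v = 1" "s \<bullet> u = 0" "t \<bullet> v = 0"
    and "(deflation u v ** shifted_augmented A \<tau> ** deflation u v) *v blockvec s t
      = - blockvec (A *v v - \<theta> *\<^sub>R u) (transpose A *v u - \<theta> *\<^sub>R v)"
  shows "shifted_augmented A \<tau> *v blockvec (s + u) (t + v)
    = blockvec ((\<theta> - \<tau> + u \<bullet> (A *v t)) *\<^sub>R u) ((\<theta> - \<tau> + v \<bullet> (transpose A *v s)) *\<^sub>R v)"
proof -
  have "u \<bullet> s = 0" "v \<bullet> t = 0"
    using assms(4,5) by (simp_all add: inner_commute)
  then have "blockvec (A *v t - \<tau> *\<^sub>R s - (u \<bullet> (A *v t)) *\<^sub>R u)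
        (transpose A *v s - \<tau> *\<^sub>R t - (v \<bullet> (transpose A *v s)) *\<^sub>R v)
      = blockvec (\<theta> *\<^sub>R u - A *v v) (\<theta> *\<^sub>R v - transpose A *v u)"
    using assms(6)
    by (simp add: matrix_vector_mul_assoc[symmetric] deflation_mult_blockvec
        shifted_augmented_mult_blockvec blockvec_minus inner_diff_right)
  then show ?thesis
    unfolding shifted_augmented_mult_blockvec blockvec_eq_iff
    by (simp add: matrix_vector_right_distrib algebra_simps)
qed

text \<open>The parallel and the orthogonal part of the right-hand side each contribute at most
  \<open>R * S / d\<close>, which explains the factor 2.\<close>

lemma projected_preimage_le:
  fixes A :: "real^'n^'m"
  assumes expands: "\<And>z. d * norm z \<le> norm (shifted_augmented A \<tau> *v z)" and "0 < d"
    and trip: "is_singular_triplet A \<sigma> ustar vstar" and "\<sigma>\<^sup>2 \<noteq> \<tau>\<^sup>2"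
    and PU: "is_orthogonal_projector PU \<U>" and PV: "is_orthogonal_projector PV \<V>"
    and u: "u \<in> \<U>" "norm u = 1" and v: "v \<in> \<V>" "norm v = 1"
    and K: "shifted_augmented A \<tau> *v blockvec a b = blockvec (\<alpha> *\<^sub>R u) (\<beta> *\<^sub>R v)"
  shows "norm (blockvec ((mat 1 - PU) *v a) ((mat 1 - PV) *v b))
    \<le> 2 * sqrt (\<alpha>\<^sup>2 + \<beta>\<^sup>2) * max (sin (acute_angle u ustar)) (sin (acute_angle v vstar)) / d"
proof -
  define S where "S = max (sin (acute_angle u ustar)) (sin (acute_angle v vstar))"
  define R where "R = sqrt (\<alpha>\<^sup>2 + \<beta>\<^sup>2)"
  have us: "norm ustar = 1" and vs: "norm vstar = 1"
    using trip by (auto simp: is_singular_triplet_def)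
  define c e where "c = ustar \<bullet> u" and "e = vstar \<bullet> v"
  have c: "\<bar>c\<bar> \<le> 1" and e: "\<bar>e\<bar> \<le> 1"
    using Cauchy_Schwarz_ineq2[of ustar u] Cauchy_Schwarz_ineq2[of vstar v] us vs u v
    by (simp_all add: c_def e_def)
  \<comment> \<open>Here the residual of \<open>u\<close> is taken off the line of
    \<open>ustar\<close>, while \<open>g\<close> below goes the other way; both lengths are the same
    sine because the angle is symmetric.\<close>
  have f: "norm (u - c *\<^sub>R ustar) \<le> S" "norm (v - e *\<^sub>R vstar) \<le> S"
    using norm_residual_unit[OF us u(2)] norm_residual_unit[OF vs v(2)]
    by (simp_all add: c_def e_def S_def acute_angle_commute)
  have g: "norm ((mat 1 - PU) *v ustar) \<le> S" "norm ((mat 1 - PV) *v vstar) \<le> S"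
    using norm_orthogonal_projector_compl_le_sin[OF PU u us]
      norm_orthogonal_projector_compl_le_sin[OF PV v vs] by (simp_all add: S_def)
  have S: "0 \<le> S"
    using f(1) norm_ge_zero order_trans by blast
  obtain p q where pq: "shifted_augmented A \<tau> *v blockvec (p *\<^sub>R ustar) (q *\<^sub>R vstar)
      = blockvec ((\<alpha> * c) *\<^sub>R ustar) ((\<beta> * e) *\<^sub>R vstar)"
    using preimage_on_triplet[OF trip assms(4)] by blast
  \<comment> \<open>Since \<open>ustar\<close> and \<open>vstar\<close> are unit vectors, the square
    root is the norm of the parallel preimage; its image has norm at most \<open>R\<close> because
    \<open>c\<close> and \<open>e\<close> are cosines up to sign.\<close>
  have "d * sqrt (p\<^sup>2 + q\<^sup>2) \<le> norm (blockvec (\<alpha> *\<^sub>R (c *\<^sub>R ustar)) (\<beta> *\<^sub>R (e *\<^sub>R vstar)))"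
    using expands[of "blockvec (p *\<^sub>R ustar) (q *\<^sub>R vstar)"] us vs unfolding pq
    by (simp add: norm_blockvec)
  also have "\<dots> \<le> R"
    using norm_blockvec_scaled_le[of "c *\<^sub>R ustar" 1 "e *\<^sub>R vstar" \<alpha> \<beta>] us vs c e
    by (simp add: R_def)
  finally have par: "sqrt (p\<^sup>2 + q\<^sup>2) \<le> R / d"
    using \<open>0 < d\<close> by (simp add: field_simps)
  \<comment> \<open>By linearity the rest of the preimage is mapped to the orthogonal part, so no
    second system has to be solved.\<close>
  define a' b' where "a' = a - p *\<^sub>R ustar" and "b' = b - q *\<^sub>R vstar"
  have "shifted_augmented A \<tau> *v blockvec a' b'
      = blockvec (\<alpha> *\<^sub>R (u - c *\<^sub>R ustar)) (\<beta> *\<^sub>R (v - e *\<^sub>R vstar))"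
    unfolding a'_def b'_def blockvec_diff[symmetric] scaleR_diff_right scaleR_scaleR
    by (simp only: matrix_vector_mult_diff_distrib K pq)
  then have "d * norm (blockvec a' b') \<le> R * S"
    using expands[of "blockvec a' b'"] norm_blockvec_scaled_le[OF f, of \<alpha> \<beta>]
    by (simp add: R_def)
  then have orth: "norm (blockvec a' b') \<le> R * S / d"
    using \<open>0 < d\<close> by (simp add: field_simps)
  have "blockvec ((mat 1 - PU) *v a) ((mat 1 - PV) *v b)
      = blockvec (p *\<^sub>R ((mat 1 - PU) *v ustar)) (q *\<^sub>R ((mat 1 - PV) *v vstar))
        + blockvec ((mat 1 - PU) *v a') ((mat 1 - PV) *v b')"
    by (simp add: blockvec_add a'_def b'_def matrix_vector_mult_diff_distrib
        matrix_vector_mult_scaleR)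
  then have "norm (blockvec ((mat 1 - PU) *v a) ((mat 1 - PV) *v b))
      \<le> norm (blockvec (p *\<^sub>R ((mat 1 - PU) *v ustar)) (q *\<^sub>R ((mat 1 - PV) *v vstar)))
        + norm (blockvec ((mat 1 - PU) *v a') ((mat 1 - PV) *v b'))"
    by (simp add: norm_triangle_ineq)
  \<comment> \<open>In the first summand the projections supply the sine \<open>S\<close>. In the
    second they merely do not increase the norm, since \<open>orth\<close> contains the sine
    already.\<close>
  also have "\<dots> \<le> sqrt (p\<^sup>2 + q\<^sup>2) * S + norm (blockvec a' b')"
    by (intro add_mono norm_blockvec_scaled_le g norm_blockvec_mono
        norm_orthogonal_projector_compl_le[OF PU] norm_orthogonal_projector_compl_le[OF PV])
  also have "\<dots> \<le> R / d * S + R * S / d"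
    using par orth S by (intro add_mono mult_right_mono)
  also have "\<dots> = 2 * R * S / d"
    by simp
  finally show ?thesis
    by (simp only: R_def S_def)
qed

section \<open>Comparison of the two error measures, and the final bound\<close>

text \<open>The errors of the parts are \<open>k *\<^sub>R g\<close> and
  \<open>k *\<^sub>R h\<close>, and each projected error is at most the larger ratio times the
  projected exact part. \<open>PU\<close> and \<open>PV\<close> stand for arbitrary matrices here;
  the theorem inserts the complementary projections \<open>mat 1 - PU\<close> and
  \<open>mat 1 - PV\<close>.\<close>

lemma relative_error_le_accuracy:
  assumes "blockvec s' t' = blockvec s t + k *\<^sub>R blockvec g h"
    and "PU *v s \<noteq> 0" "PV *v t \<noteq> 0" and "0 \<le> k"
  shows "k * norm (blockvec (PU *v g) (PV *v h))
    \<le> max (norm (PU *v (s' - s)) / norm (PU *v s)) (norm (PV *v (t' - t)) / norm (PV *v t))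
      * norm (blockvec (PU *v s) (PV *v t))" (is "_ \<le> ?m * _")
proof -
  have m: "0 \<le> ?m"
    by (simp add: le_max_iff_disj)
  have "s' = s + k *\<^sub>R g" "t' = t + k *\<^sub>R h"
    using assms(1) by (simp_all add: blockvec_scaleR blockvec_add blockvec_eq_iff)
  then have "s' - s = k *\<^sub>R g" "t' - t = k *\<^sub>R h"
    by simp_all
  then have "k * norm (blockvec (PU *v g) (PV *v h)) = norm (blockvec (PU *v (s' - s)) (PV *v (t' - t)))"
    using assms(4) by (simp add: matrix_vector_mult_scaleR flip: blockvec_scaleR)
  also have "\<dots> \<le> norm (blockvec (?m *\<^sub>R (PU *v s)) (?m *\<^sub>R (PV *v t)))"
  proof (rule norm_blockvec_mono)
    have "norm (PU *v (s' - s)) / norm (PU *v s) \<le> ?m" "norm (PV *v (t' - t)) / norm (PV *v t) \<le> ?m"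
      by simp_all
    then show "norm (PU *v (s' - s)) \<le> norm (?m *\<^sub>R (PU *v s))"
      "norm (PV *v (t' - t)) \<le> norm (?m *\<^sub>R (PV *v t))"
      using assms(2,3) unfolding norm_scaleR abs_of_nonneg[OF m]
      by (metis pos_divide_le_eq zero_less_norm_iff)+
  qed
  also have "\<dots> = ?m * norm (blockvec (PU *v s) (PV *v t))"
    using m by (simp only: blockvec_scaleR[symmetric] norm_scaleR abs_of_nonneg)
  finally show ?thesis .
qed

theorem theorem3p3:
  fixes A :: "real^'N^'M"
    and \<sigma> :: "nat \<Rightarrow> real" and \<tau> :: real
    and ustar :: "real^'M" and vstar :: "real^'N"
    and \<U> :: "(real^'M) set" and \<V> :: "(real^'N) set" and m :: nat
    and PU :: "real^'M^'M" and PV :: "real^'N^'N"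
    and u s s' g :: "real^'M" and v t t' h :: "real^'N"
    and B :: "real^('M + 'N)^('M + 'N)" and r :: "real^('M + 'N)"
    and \<theta> \<alpha> \<beta> \<epsilon> \<epsilon>s \<epsilon>t \<phi> \<psi> :: real
    and gperp :: "real^'M" and hperp :: "real^'N"
  assumes "B = matrix_inv (shifted_augmented A \<tau>)"
    and "\<theta> = u \<bullet> (A *v v)"
    and "r = blockvec (A *v v - \<theta> *\<^sub>R u) (transpose A *v u - \<theta> *\<^sub>R v)"
    and "\<alpha> = \<theta> - \<tau> + u \<bullet> (A *v t)"
    and "\<beta> = \<theta> - \<tau> + v \<bullet> (transpose A *v s)"
    and "\<epsilon> = norm (blockvec s' t' - blockvec s t) / norm (blockvec s t)"
    and "gperp = (mat 1 - PU) *v g"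
    and "hperp = (mat 1 - PV) *v h"
    and "\<epsilon>s = norm ((mat 1 - PU) *v (s' - s)) / norm ((mat 1 - PU) *v s)"
    and "\<epsilon>t = norm ((mat 1 - PV) *v (t' - t)) / norm ((mat 1 - PV) *v t)"
    and "\<phi> = acute_angle u ustar"
    and "\<psi> = acute_angle v vstar"
    and "CARD('N) \<le> CARD('M)"
    and "are_singular_values A \<sigma>"
    and "2 \<le> CARD('N) \<Longrightarrow> \<bar>\<sigma> 1 - \<tau>\<bar> < \<bar>\<sigma> 2 - \<tau>\<bar>"
    and "\<And>i. 2 \<le> i \<Longrightarrow> i < CARD('N) \<Longrightarrow> \<bar>\<sigma> i - \<tau>\<bar> \<le> \<bar>\<sigma> (Suc i) - \<tau>\<bar>"
    and "\<tau> > 0"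
    and "\<And>i. i \<in> {1..CARD('N)} \<Longrightarrow> \<sigma> i \<noteq> \<tau>"
    and "CARD('N) < CARD('M) \<Longrightarrow> \<bar>\<sigma> 1 - \<tau>\<bar> \<le> \<tau>"
    and "is_singular_triplet A (\<sigma> 1) ustar vstar"
    and "subspace \<U>" and "dim \<U> = m" and "is_orthogonal_projector PU \<U>"
    and "subspace \<V>" and "dim \<V> = m" and "is_orthogonal_projector PV \<V>"
    and "u \<in> \<U>" and "norm u = 1"
    and "v \<in> \<V>" and "norm v = 1"
    and "\<theta> \<ge> 0"
    and "(deflation u v ** shifted_augmented A \<tau> ** deflation u v) *v blockvec s t = - r"
    and "s \<bullet> u = 0" and "t \<bullet> v = 0"
    and "blockvec s' t' = blockvec s t + (\<epsilon> * norm (blockvec s t)) *\<^sub>R blockvec g h"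
    and "(norm g)\<^sup>2 + (norm h)\<^sup>2 = 1"
    and "blockvec s t \<noteq> 0"
    and "(mat 1 - PU) *v s \<noteq> 0" and "(mat 1 - PV) *v t \<noteq> 0"
    and "B *v blockvec (\<alpha> *\<^sub>R u) (\<beta> *\<^sub>R v) - blockvec u v \<noteq> 0"
    and "(norm gperp)\<^sup>2 + (norm hperp)\<^sup>2 \<noteq> 0"
  shows "\<epsilon> \<le> 2 * sqrt (\<alpha>\<^sup>2 + \<beta>\<^sup>2) * max (sin \<phi>) (sin \<psi>)
           / (\<bar>\<sigma> 1 - \<tau>\<bar> * norm (B *v blockvec (\<alpha> *\<^sub>R u) (\<beta> *\<^sub>R v) - blockvec u v)
              * sqrt ((norm gperp)\<^sup>2 + (norm hperp)\<^sup>2))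
           * max \<epsilon>s \<epsilon>t"
proof -
  let ?K = "shifted_augmented A \<tau>"
  let ?S = "max (sin \<phi>) (sin \<psi>)"
  define d where "d = \<bar>\<sigma> 1 - \<tau>\<bar>"
  have one: "1 \<in> {1..CARD('N)}"
    by (simp add: Suc_leI)
  have "0 < d"
    using assms(18)[OF one] by (simp add: d_def)
  have "0 \<le> \<sigma> 1"
    using assms(14) one by (auto simp: are_singular_values_def)
  \<comment> \<open>The other root \<open>\<sigma> 1 = - \<tau>\<close> is excluded by sign.\<close>
  then have sq: "(\<sigma> 1)\<^sup>2 \<noteq> \<tau>\<^sup>2"
    using assms(17) assms(18)[OF one] by (simp add: power2_eq_iff)
  \<comment> \<open>The ordering is chained upwards from index 1: the step from 1 to 2 uses the
    strict gap, every later one the weak monotonicity.\<close>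
  have "d \<le> \<bar>\<sigma> i - \<tau>\<bar>" if "i \<in> {1..CARD('N)}" for i
  proof -
    have "1 \<le> i" "i \<le> CARD('N)"
      using that by auto
    then show ?thesis
    proof (induction i rule: dec_induct)
      case (step n)
      then show ?case
        using assms(15) assms(16)[of n] by (cases "n = 1") (auto simp: d_def numeral_2_eq_2)
    qed (simp add: d_def)
  qed
  then have expands: "d * norm z \<le> norm (?K *v z)" for z
    using assms(13,14,17,19) \<open>0 < d\<close>
    by (intro shifted_augmented_expands[of A \<sigma>]) (auto simp: d_def)
  \<comment> \<open>Expansion by the positive factor \<open>d\<close> leaves no kernel, so
    \<open>B\<close> is a genuine inverse.\<close>
  have "inj ((*v) ?K)"
  proof (rule injI)
    fix x y
    assume "?K *v x = ?K *v y"
    then have "d * norm (x - y) \<le> 0"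
      using expands[of "x - y"] by (simp add: matrix_vector_mult_diff_distrib)
    then show "x = y"
      using \<open>0 < d\<close> by (simp add: mult_le_0_iff)
  qed
  have K: "?K *v blockvec (s + u) (t + v) = blockvec (\<alpha> *\<^sub>R u) (\<beta> *\<^sub>R v)"
    unfolding assms(4,5) 
    by (rule correction_solution_eq[OF assms(2,28,30,33,34)]) (use assms(3,32) in simp)
  then have "B *v blockvec (\<alpha> *\<^sub>R u) (\<beta> *\<^sub>R v) = blockvec (s + u) (t + v)"
    using matrix_inv_mult_vector_eq[OF \<open>inj ((*v) ?K)\<close>] assms(1) by metis
  \<comment> \<open>This turns the norm in the denominator of the bound into that of the exact
    solution.\<close>
  then have w: "B *v blockvec (\<alpha> *\<^sub>R u) (\<beta> *\<^sub>R v) - blockvec u v = blockvec s t"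
    by (simp add: blockvec_diff)
  have "norm (blockvec ((mat 1 - PU) *v (s + u)) ((mat 1 - PV) *v (t + v)))
      \<le> 2 * sqrt (\<alpha>\<^sup>2 + \<beta>\<^sup>2) * ?S / d"
    unfolding assms(11,12)
    by (rule projected_preimage_le[OF expands \<open>0 < d\<close> assms(20) sq assms(23,26,27,28,29,30) K])
  then have proj: "norm (blockvec ((mat 1 - PU) *v s) ((mat 1 - PV) *v t)) \<le> 2 * sqrt (\<alpha>\<^sup>2 + \<beta>\<^sup>2) * ?S / d"
    by (simp add: matrix_vector_right_distrib orthogonal_projector_annihilates[OF assms(23,27)]
        orthogonal_projector_annihilates[OF assms(26,29)])
  have "0 \<le> \<epsilon>s" and k: "0 \<le> \<epsilon> * norm (blockvec s t)"
    using assms(6,9) by simp_all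
  have "\<epsilon> * norm (blockvec s t) * norm (blockvec gperp hperp)
      \<le> max \<epsilon>s \<epsilon>t * norm (blockvec ((mat 1 - PU) *v s) ((mat 1 - PV) *v t))"
    unfolding assms(7-10) by (rule relative_error_le_accuracy[OF assms(35,38,39) k])
  also have "\<dots> \<le> max \<epsilon>s \<epsilon>t * (2 * sqrt (\<alpha>\<^sup>2 + \<beta>\<^sup>2) * ?S / d)"
    using proj \<open>0 \<le> \<epsilon>s\<close> by (intro mult_left_mono) auto
  \<comment> \<open>Upper bound on the projected exact solution and lower bound by the projected
    error direction are now combined; dividing by the two norms on the left gives the claim.\<close>
  finally have main: "\<epsilon> * (norm (blockvec s t) * norm (blockvec gperp hperp))
      \<le> 2 * sqrt (\<alpha>\<^sup>2 + \<beta>\<^sup>2) * ?S / d * max \<epsilon>s \<epsilon>t"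
    by (simp only: mult_ac)
  have "0 < norm (blockvec gperp hperp)"
    unfolding norm_blockvec using assms(41) by (simp add: order_less_le)
  then have pos: "0 < norm (blockvec s t) * norm (blockvec gperp hperp)"
    using assms(37) by simp
  have "\<epsilon> \<le> 2 * sqrt (\<alpha>\<^sup>2 + \<beta>\<^sup>2) * ?S / d * max \<epsilon>s \<epsilon>t
      / (norm (blockvec s t) * norm (blockvec gperp hperp))"
    using main pos by (simp only: pos_le_divide_eq)
  also have "\<dots> = 2 * sqrt (\<alpha>\<^sup>2 + \<beta>\<^sup>2) * ?S
      / (d * norm (blockvec s t) * norm (blockvec gperp hperp)) * max \<epsilon>s \<epsilon>t"
    by (simp add: divide_divide_eq_left mult.assoc)
  finally show ?thesis
    unfolding w d_def norm_blockvec[of gperp hperp] .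
qed

end
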